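(* Let $(M,F)$ be an $n$-dimensional Landsberg space admitting a (nonzero) parallel 1-form. Then the rank of the mean Berwald curvature $(E_{jk})$ is at most $n-2$.
   Context: $M$ is a smooth manifold of dimension $n\ge 2$, $\mathcal{T}M$ is the bundle of nonzero tangent vectors (slit tangent bundle), $(x^i,y^i)$ are the induced coordinates on $TM$, $\partial_i=\partial/\partial x^i$, $\dot\partial_i=\partial/\partial y^i$; the summation convention is used. A Finsler space $(M,F)$ is such an $M$ with a function $F:TM\to\mathbb{R}$ that is strictly positive and smooth on $\mathcal{T}M$, positively 1-homogeneous in $y$, and such that $g_{ij}=\dot\partial_i\dot\partial_j(\tfrac12F^2)$ has rank $n$. Its geodesic spray is $S=y^j\partial_j-2G^j\dot\partial_j$, with $G^i=\tfrac14 g^{il}\left(y^k\partial_k\dot\partial_l F^2-\partial_l F^2\right)$. Put $G^h_j=\dot\partial_jG^h$, $G^h_{ij}=\dot\partial_iG^h_j$ (Berwald connection coefficients), $G^h_{ijk}=\dot\partial_kG^h_{ij}$ (Berwald curvature). The Landsberg curvature is $L_{ijk}=-\tfrac12F\,G^h_{ijk}\,\dot\partial_hF$; $(M,F)$ is a Landsberg space if $L_{ijk}\equiv 0$. The mean Berwald curvature is $E_{jk}=\tfrac12G^i_{ijk}=\tfrac12\dot\partial_i\dot\partial_j\dot\partial_kG^i$. A 1-form $\beta=b_i(x)y^i$ is parallel if its Berwald horizontal covariant derivative vanishes: $b_{i|j}=\partial_jb_i-G^h_{ij}b_h=0$ on $\mathcal{T}M$. Parallel 1-forms are understood to be nonzero.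 *)

theory Defs
  imports "HOL-Analysis.Analysis"
begin

section \<open>Smooth maps on open sets\<close>

primrec Ck_on :: "nat \<Rightarrow> 'a::real_normed_vector set \<Rightarrow> ('a \<Rightarrow> 'b::real_normed_vector) \<Rightarrow> bool" where
  "Ck_on 0 S f \<longleftrightarrow> continuous_on S f"
| "Ck_on (Suc k) S f \<longleftrightarrow>
     (\<forall>x\<in>S. f differentiable (at x)) \<and>
     (\<forall>v. Ck_on k S (\<lambda>x. frechet_derivative f (at x) v))"

text \<open>Only meaningful for open \<open>S\<close> in a finite-dimensional space, which is the only use below.\<close>

definition smooth_on :: "'a::real_normed_vector set \<Rightarrow> ('a \<Rightarrow> 'b::real_normed_vector) \<Rightarrow> bool" where
  "smooth_on S f \<longleftrightarrow> (\<forall>k. Ck_on k S f)"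


section \<open>Smooth manifolds and the tangent bundle\<close>

text \<open>A chart is a pair of its domain and its coordinate map; the values of the coordinate map
  outside the domain are irrelevant.\<close>

type_synonym ('m, 'n) chart = "'m set \<times> ('m \<Rightarrow> (real, 'n) vec)"

definition chart_image :: "('m, 'n::finite) chart \<Rightarrow> (real^'n) set" where
  "chart_image c = snd c ` fst c"

definition chart_inv :: "('m, 'n::finite) chart \<Rightarrow> real^'n \<Rightarrow> 'm" where
  "chart_inv c = inv_into (fst c) (snd c)"

definition is_chart :: "('m::topological_space, 'n::finite) chart \<Rightarrow> bool" where
  "is_chart c \<longleftrightarrow> open (fst c) \<and> open (chart_image c) \<and>
     homeomorphism (fst c) (chart_image c) (snd c) (chart_inv c)"

definition transition :: "('m, 'n::finite) chart \<Rightarrow> ('m, 'n) chart \<Rightarrow> real^'n \<Rightarrow> real^'n" where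
  "transition c d = snd d \<circ> chart_inv c"

text \<open>The manifold is the whole type \<open>'m\<close>, with dimension \<open>CARD('n)\<close>. The atlas need not be
  maximal.\<close>

definition smooth_manifold ::
  "('m::{t2_space,second_countable_topology}, 'n::finite) chart set \<Rightarrow> bool" where
  "smooth_manifold A \<longleftrightarrow>
     (\<forall>c\<in>A. is_chart c) \<and> (\<Union>c\<in>A. fst c) = UNIV \<and>
     (\<forall>c\<in>A. \<forall>d\<in>A. smooth_on (snd c ` (fst c \<inter> fst d)) (transition c d))"

text \<open>A tangent vector at \<open>p\<close> is the family of its component vectors in all charts around \<open>p\<close>,
  related by the Jacobians of the transition maps. The family is 0 on all other charts, so that
  distinct families are distinct tangent vectors.\<close>

type_synonym ('m, 'n) tvec = "('m, 'n) chart \<Rightarrow> (real, 'n) vec"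

definition tangent_space :: "('m, 'n::finite) chart set \<Rightarrow> 'm \<Rightarrow> ('m, 'n) tvec set" where
  "tangent_space A p = {v.
     (\<forall>c. \<not> (c \<in> A \<and> p \<in> fst c) \<longrightarrow> v c = 0) \<and>
     (\<forall>c\<in>A. \<forall>d\<in>A. p \<in> fst c \<longrightarrow> p \<in> fst d \<longrightarrow>
        v d = frechet_derivative (transition c d) (at (snd c p)) (v c))}"

text \<open>The tangent vector \<open>y\<^sup>i \<partial>\<^sub>i\<close> at the point with coordinates \<open>x\<close> in the chart \<open>c\<close>.\<close>

definition coord_tvec ::
  "('m, 'n::finite) chart set \<Rightarrow> ('m, 'n) chart \<Rightarrow> real^'n \<Rightarrow> real^'n \<Rightarrow> ('m, 'n) tvec" where
  "coord_tvec A c x y = (\<lambda>d. if d \<in> A \<and> chart_inv c x \<in> fst d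
     then frechet_derivative (transition c d) (at x) y else 0)"

text \<open>Expression of a function on \<open>TM\<close> in the induced coordinates \<open>(x, y)\<close>. A function on \<open>TM\<close> is
  a function of pairs \<open>(p, v)\<close> whose values for \<open>v\<close> outside \<open>tangent_space A p\<close> are irrelevant.\<close>

definition local_rep ::
  "('m, 'n::finite) chart set \<Rightarrow> ('m \<times> ('m, 'n) tvec \<Rightarrow> real) \<Rightarrow> ('m, 'n) chart \<Rightarrow>
     (real^'n) \<times> (real^'n) \<Rightarrow> real" where
  "local_rep A f c = (\<lambda>(x, y). f (chart_inv c x, coord_tvec A c x y))"

definition slit_coords :: "('m, 'n::finite) chart \<Rightarrow> ((real^'n) \<times> (real^'n)) set" where
  "slit_coords c = chart_image c \<times> (- {0})"


section \<open>Local Finsler geometry\<close>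

text \<open>In this section \<open>F\<close> is a function of induced coordinates \<open>z = (x, y)\<close>; \<open>dx i\<close> and \<open>dy i\<close>
  are the partial derivatives with respect to \<open>x\<^sup>i\<close> and \<open>y\<^sup>i\<close>.\<close>

definition dx :: "'n::finite \<Rightarrow> ((real^'n) \<times> (real^'n) \<Rightarrow> real) \<Rightarrow> (real^'n) \<times> (real^'n) \<Rightarrow> real" where
  "dx i f = (\<lambda>z. frechet_derivative f (at z) (axis i 1, 0))"

definition dy :: "'n::finite \<Rightarrow> ((real^'n) \<times> (real^'n) \<Rightarrow> real) \<Rightarrow> (real^'n) \<times> (real^'n) \<Rightarrow> real" where
  "dy i f = (\<lambda>z. frechet_derivative f (at z) (0, axis i 1))"

definition metric_tensor ::
  "((real^'n::finite) \<times> (real^'n) \<Rightarrow> real) \<Rightarrow> (real^'n) \<times> (real^'n) \<Rightarrow> real^'n^'n" where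
  "metric_tensor F z = (\<chi> i j. dy i (dy j (\<lambda>w. (F w)\<^sup>2 / 2)) z)"

text \<open>The coefficients \<open>G\<^sup>i\<close> of the geodesic spray.\<close>

definition spray ::
  "((real^'n::finite) \<times> (real^'n) \<Rightarrow> real) \<Rightarrow> 'n \<Rightarrow> (real^'n) \<times> (real^'n) \<Rightarrow> real" where
  "spray F i = (\<lambda>z. 1/4 * (\<Sum>l\<in>UNIV. matrix_inv (metric_tensor F z) $ i $ l *
     ((\<Sum>k\<in>UNIV. snd z $ k * dx k (dy l (\<lambda>w. (F w)\<^sup>2)) z) - dx l (\<lambda>w. (F w)\<^sup>2) z)))"

text \<open>\<open>nonlinear_conn F h j\<close>, \<open>berwald_conn F h i j\<close> and \<open>berwald_curv F h i j k\<close> are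
  \<open>G\<^sup>h\<^sub>j\<close>, \<open>G\<^sup>h\<^sub>i\<^sub>j\<close> and \<open>G\<^sup>h\<^sub>i\<^sub>j\<^sub>k\<close>.\<close>

definition nonlinear_conn ::
  "((real^'n::finite) \<times> (real^'n) \<Rightarrow> real) \<Rightarrow> 'n \<Rightarrow> 'n \<Rightarrow> (real^'n) \<times> (real^'n) \<Rightarrow> real" where
  "nonlinear_conn F h j = dy j (spray F h)"

definition berwald_conn ::
  "((real^'n::finite) \<times> (real^'n) \<Rightarrow> real) \<Rightarrow> 'n \<Rightarrow> 'n \<Rightarrow> 'n \<Rightarrow> (real^'n) \<times> (real^'n) \<Rightarrow> real" where
  "berwald_conn F h i j = dy i (nonlinear_conn F h j)"

definition berwald_curv ::
  "((real^'n::finite) \<times> (real^'n) \<Rightarrow> real) \<Rightarrow> 'n \<Rightarrow> 'n \<Rightarrow> 'n \<Rightarrow> 'n \<Rightarrow>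
     (real^'n) \<times> (real^'n) \<Rightarrow> real" where
  "berwald_curv F h i j k = dy k (berwald_conn F h i j)"

definition landsberg_curv ::
  "((real^'n::finite) \<times> (real^'n) \<Rightarrow> real) \<Rightarrow> 'n \<Rightarrow> 'n \<Rightarrow> 'n \<Rightarrow> (real^'n) \<times> (real^'n) \<Rightarrow> real" where
  "landsberg_curv F i j k =
     (\<lambda>z. - (1/2) * F z * (\<Sum>h\<in>UNIV. berwald_curv F h i j k z * dy h F z))"

definition mean_berwald ::
  "((real^'n::finite) \<times> (real^'n) \<Rightarrow> real) \<Rightarrow> (real^'n) \<times> (real^'n) \<Rightarrow> real^'n^'n" where
  "mean_berwald F z = (\<chi> j k. 1/2 * (\<Sum>i\<in>UNIV. berwald_curv F i i j k z))"


section \<open>Finsler spaces, Landsberg spaces, parallel 1-forms\<close>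

definition finsler_space ::
  "('m::{t2_space,second_countable_topology}, 'n::finite) chart set \<Rightarrow>
     ('m \<times> ('m, 'n) tvec \<Rightarrow> real) \<Rightarrow> bool" where
  "finsler_space A F \<longleftrightarrow>
     smooth_manifold A \<and> CARD('n) \<ge> 2 \<and>
     (\<forall>p. \<forall>v\<in>tangent_space A p. v \<noteq> (\<lambda>_. 0) \<longrightarrow> F (p, v) > 0) \<and>
     (\<forall>c\<in>A. smooth_on (slit_coords c) (local_rep A F c)) \<and>
     (\<forall>p. \<forall>v\<in>tangent_space A p. \<forall>t>0. F (p, \<lambda>c. t *\<^sub>R v c) = t * F (p, v)) \<and>
     (\<forall>c\<in>A. \<forall>z\<in>slit_coords c. rank (metric_tensor (local_rep A F c) z) = CARD('n))"

definition landsberg_space ::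
  "('m::{t2_space,second_countable_topology}, 'n::finite) chart set \<Rightarrow>
     ('m \<times> ('m, 'n) tvec \<Rightarrow> real) \<Rightarrow> bool" where
  "landsberg_space A F \<longleftrightarrow> finsler_space A F \<and>
     (\<forall>c\<in>A. \<forall>z\<in>slit_coords c. \<forall>i j k. landsberg_curv (local_rep A F c) i j k z = 0)"

text \<open>The components \<open>b\<^sub>i = \<beta>(\<partial>\<^sub>i)\<close> of a 1-form in a chart.\<close>

definition form_comp ::
  "('m, 'n::finite) chart set \<Rightarrow> ('m \<times> ('m, 'n) tvec \<Rightarrow> real) \<Rightarrow> ('m, 'n) chart \<Rightarrow> 'n \<Rightarrow>
     real^'n \<Rightarrow> real" where
  "form_comp A \<beta> c i = (\<lambda>x. local_rep A \<beta> c (x, axis i 1))"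

definition one_form ::
  "('m::{t2_space,second_countable_topology}, 'n::finite) chart set \<Rightarrow>
     ('m \<times> ('m, 'n) tvec \<Rightarrow> real) \<Rightarrow> bool" where
  "one_form A \<beta> \<longleftrightarrow>
     (\<forall>c\<in>A. (\<forall>i. smooth_on (chart_image c) (form_comp A \<beta> c i)) \<and>
        (\<forall>x\<in>chart_image c. \<forall>y. local_rep A \<beta> c (x, y) = (\<Sum>i\<in>UNIV. form_comp A \<beta> c i x * y $ i)))"

definition parallel_form ::
  "('m::{t2_space,second_countable_topology}, 'n::finite) chart set \<Rightarrow>
     ('m \<times> ('m, 'n) tvec \<Rightarrow> real) \<Rightarrow> ('m \<times> ('m, 'n) tvec \<Rightarrow> real) \<Rightarrow> bool" where
  "parallel_form A F \<beta> \<longleftrightarrow> one_form A \<beta> \<and>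
     (\<forall>c\<in>A. \<forall>(x, y)\<in>slit_coords c. \<forall>i j.
        frechet_derivative (form_comp A \<beta> c i) (at x) (axis j 1)
          - (\<Sum>h\<in>UNIV. berwald_conn (local_rep A F c) h i j (x, y) * form_comp A \<beta> c h x) = 0)"

text \<open>On a connected manifold, \<open>nonzero_form\<close> says that \<open>\<beta>\<close> is not identically zero. The manifold is
  not assumed connected here, so the form must not vanish identically on any connected component:
  nothing about \<open>F\<close> follows on a component on which \<open>\<beta>\<close> is zero.\<close>

definition nonzero_form ::
  "('m::{t2_space,second_countable_topology}, 'n::finite) chart set \<Rightarrow>
     ('m \<times> ('m, 'n) tvec \<Rightarrow> real) \<Rightarrow> bool" where
  "nonzero_form A \<beta> \<longleftrightarrow>
     (\<forall>p. \<exists>q \<in> connected_component_set UNIV p. \<exists>v\<in>tangent_space A q. \<beta> (q, v) \<noteq> 0)"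

end

theory Submission
  imports Defs
begin

text \<open>Work in a chart and put \<open>p\<^sub>h = \<partial>(F\<^sup>2/2)/\<partial>y\<^sup>h\<close>, so that \<open>\<partial>p\<^sub>h/\<partial>y\<^sup>m = g\<^sub>m\<^sub>h\<close>. Two covectors annihilate
  the upper index of the Berwald curvature \<open>G\<^sup>h\<^sub>i\<^sub>j\<^sub>k\<close>. One is \<open>p\<close>, because \<open>p\<^sub>h = F \<partial>F/\<partial>y\<^sup>h\<close> and the
  Landsberg curvature is zero. The other is \<open>b\<close>: by parallelism the sum \<open>G\<^sup>h\<^sub>i\<^sub>j b\<^sub>h = \<partial>\<^sub>j b\<^sub>i\<close> does
  not depend on \<open>y\<close>, and one differentiates it in \<open>y\<^sup>k\<close>.

  Differentiating \<open>p\<^sub>h G\<^sup>h\<^sub>i\<^sub>j\<^sub>k = 0\<close> in \<open>y\<^sup>m\<close> gives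
  \<open>g\<^sub>m\<^sub>h G\<^sup>h\<^sub>i\<^sub>j\<^sub>k = - p\<^sub>h \<partial>\<^sup>2G\<^sup>h\<^sub>i\<^sub>j/\<partial>y\<^sup>m\<partial>y\<^sup>k\<close>, whose right-hand side is symmetric in \<open>m\<close> and \<open>k\<close>
  (\<open>landsberg_berwald_curv_swap\<close>). The lowered upper index can thus be exchanged with a lower one,
  so a vector \<open>u\<close> whose metric dual annihilates the upper index also satisfies
  \<open>G\<^sup>h\<^sub>i\<^sub>j\<^sub>k u\<^sup>k = 0\<close>, and lies in the kernel of the mean Berwald curvature
  (\<open>mean_berwald_kernel\<close>).

  Where \<open>p\<close> and \<open>b\<close> are independent, this gives two independent kernel vectors. Where
  \<open>p = \<mu> b\<close>, the covector \<open>q = p - \<mu> b\<close> with this constant \<open>\<mu>\<close> vanishes at the point in question,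
  while \<open>q\<^sub>h G\<^sup>h\<^sub>i\<^sub>j\<^sub>k = 0\<close> for all \<open>y\<close> over the same \<open>x\<close>; differentiating in \<open>y\<^sup>m\<close> leaves
  \<open>g\<^sub>m\<^sub>h G\<^sup>h\<^sub>i\<^sub>j\<^sub>k = 0\<close> there, so the whole Berwald curvature is zero at that point. Both cases are in
  \<open>landsberg_rank_mean_berwald\<close>.

  These two cases are exhaustive because \<open>b\<close> is not zero at the base point. For a fixed \<open>y\<close> the equations
  \<open>\<partial>\<^sub>j b\<^sub>i = G\<^sup>h\<^sub>i\<^sub>j b\<^sub>h\<close> form a linear differential system for \<open>b\<close> with continuous coefficients, so the
  zero set of a parallel form is open; it is closed as well, and hence cannot meet a connected
  component on which the form is nonzero somewhere (\<open>parallel_form_nowhere_zero\<close>).\<close>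

section \<open>Smooth maps\<close>

lemma Ck_on_cong:
  assumes "open S" "\<And>x. x \<in> S \<Longrightarrow> f x = g x" "Ck_on k S f"
  shows "Ck_on k S g"
  using assms(2,3)
proof (induction k arbitrary: f g)
  case 0
  then show ?case by (simp cong: continuous_on_cong)
next
  case (Suc k)
  have diff: "f differentiable (at x)" if "x \<in> S" for x
    using Suc.prems(2) that by simp
  have "g differentiable (at x)" if x: "x \<in> S" for x
    using diff[OF x] has_derivative_transform_within_open[where f = f and g = g, OF _ \<open>open S\<close> x Suc.prems(1)]
    unfolding differentiable_def by blast
  moreover have "Ck_on k S (\<lambda>x. frechet_derivative g (at x) v)" for v
  proof (rule Suc.IH)
    show "frechet_derivative f (at x) v = frechet_derivative g (at x) v" if x: "x \<in> S" for x
      using frechet_derivative_transform_within_open[OF diff[OF x] \<open>open S\<close> x] Suc.prems(1) by metis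
    show "Ck_on k S (\<lambda>x. frechet_derivative f (at x) v)"
      using Suc.prems(2) by simp
  qed
  ultimately show ?case by simp
qed

lemma Ck_on_Suc_imp_Ck_on: "Ck_on (Suc k) S f \<Longrightarrow> Ck_on k S f"
proof (induction k arbitrary: f)
  case 0
  then show ?case
    by (auto intro!: continuous_at_imp_continuous_on differentiable_imp_continuous_within)
next
  case (Suc k)
  from Suc.prems have "\<forall>x\<in>S. f differentiable (at x)"
    and D: "\<And>v. Ck_on (Suc k) S (\<lambda>x. frechet_derivative f (at x) v)"
    by (auto simp only: Ck_on.simps(2)[of "Suc k"])
  moreover have "Ck_on k S (\<lambda>x. frechet_derivative f (at x) v)" for v
    by (rule Suc.IH[OF D])
  ultimately show ?case by simp
qed

text \<open>The derivative may be given by any formula valid on \<open>S\<close>, which need not agree with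
  \<open>frechet_derivative\<close> outside; this is how the inductions below feed in the differentiation rules.\<close>

lemma Ck_on_SucI:
  assumes "open S" "\<And>x. x \<in> S \<Longrightarrow> (f has_derivative f' x) (at x)"
    and "\<And>v. Ck_on k S (\<lambda>x. f' x v)"
  shows "Ck_on (Suc k) S f"
proof -
  have eq: "f' x = frechet_derivative f (at x)" if "x \<in> S" for x
    using frechet_derivative_at assms(2)[OF that] by blast
  have "Ck_on k S (\<lambda>x. frechet_derivative f (at x) v)" for v
    by (rule Ck_on_cong[OF assms(1) _ assms(3)]) (simp add: eq)
  then show ?thesis
    using assms(2) by (auto simp: differentiable_def)
qed

lemma Ck_on_Suc_has_derivative:
  assumes "Ck_on (Suc k) S f" "x \<in> S"
  shows "(f has_derivative frechet_derivative f (at x)) (at x)"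
  using assms frechet_derivative_works by auto

lemma Ck_on_const: "Ck_on k S (\<lambda>x. c)"
  by (induction k arbitrary: c) auto

lemma Ck_on_bounded_linear: "open S \<Longrightarrow> bounded_linear f \<Longrightarrow> Ck_on k S f"
proof (cases k)
  case (Suc l)
  assume "open S" "bounded_linear f"
  then show ?thesis
    unfolding Suc
    by (intro Ck_on_SucI[where f' = "\<lambda>_. f"] bounded_linear_imp_has_derivative Ck_on_const)
qed (simp add: linear_continuous_on)

lemma Ck_on_add:
  assumes "open S" "Ck_on k S f" "Ck_on k S g"
  shows "Ck_on k S (\<lambda>x. f x + g x)"
  using assms(2,3)
proof (induction k arbitrary: f g)
  case 0
  then show ?case by (auto intro: continuous_on_add)
next
  case (Suc k)
  show ?case
  proof (rule Ck_on_SucI[OF \<open>open S\<close>])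
    show "((\<lambda>x. f x + g x) has_derivative
        (\<lambda>v. frechet_derivative f (at x) v + frechet_derivative g (at x) v)) (at x)" if "x \<in> S" for x
      using Suc.prems by (intro has_derivative_add Ck_on_Suc_has_derivative[OF _ that])
  qed (use Suc in auto)
qed

lemma Ck_on_mult:
  fixes f g :: "'a::real_normed_vector \<Rightarrow> real"
  assumes "open S" "Ck_on k S f" "Ck_on k S g"
  shows "Ck_on k S (\<lambda>x. f x * g x)"
  using assms(2,3)
proof (induction k arbitrary: f g)
  case 0
  then show ?case by (auto intro: continuous_on_mult)
next
  case (Suc k)
  show ?case
  proof (rule Ck_on_SucI[OF \<open>open S\<close>])
    show "((\<lambda>x. f x * g x) has_derivative
        (\<lambda>v. f x * frechet_derivative g (at x) v + frechet_derivative f (at x) v * g x)) (at x)"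
      if "x \<in> S" for x
      using Suc.prems by (intro has_derivative_mult Ck_on_Suc_has_derivative[OF _ that])
    show "Ck_on k S (\<lambda>x. f x * frechet_derivative g (at x) v + frechet_derivative f (at x) v * g x)" for v
      using Suc.prems by (intro Ck_on_add[OF \<open>open S\<close>] Suc.IH)
        (auto dest: Ck_on_Suc_imp_Ck_on simp del: Ck_on.simps(2), auto)
  qed
qed

lemma Ck_on_inverse:
  fixes f :: "'a::real_normed_vector \<Rightarrow> real"
  assumes "open S" "Ck_on k S f" "\<And>x. x \<in> S \<Longrightarrow> f x \<noteq> 0"
  shows "Ck_on k S (\<lambda>x. inverse (f x))"
  using assms(2)
proof (induction k)
  case 0
  then show ?case using assms(3) by (auto intro: continuous_on_inverse)
next
  case (Suc k)
  show ?case
  proof (rule Ck_on_SucI[OF \<open>open S\<close>])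
    show "((\<lambda>x. inverse (f x)) has_derivative
        (\<lambda>v. - (inverse (f x) * frechet_derivative f (at x) v * inverse (f x)))) (at x)" if "x \<in> S" for x
      using Deriv.has_derivative_inverse[OF assms(3)[OF that] Ck_on_Suc_has_derivative[OF Suc.prems that]] .
    have inv: "Ck_on k S (\<lambda>x. inverse (f x))"
      using Suc Ck_on_Suc_imp_Ck_on by blast
    have D: "Ck_on k S (\<lambda>x. frechet_derivative f (at x) v)" for v
      using Suc.prems by simp
    have "Ck_on k S (\<lambda>x. (- 1) * ((inverse (f x) * frechet_derivative f (at x) v) * inverse (f x)))" for v
      by (intro Ck_on_mult Ck_on_const inv D \<open>open S\<close>)
    then show "Ck_on k S (\<lambda>x. - (inverse (f x) * frechet_derivative f (at x) v * inverse (f x)))" for v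
      by simp
  qed
qed

lemma smooth_on_cong:
  "open S \<Longrightarrow> (\<And>x. x \<in> S \<Longrightarrow> f x = g x) \<Longrightarrow> smooth_on S f \<Longrightarrow> smooth_on S g"
  unfolding smooth_on_def using Ck_on_cong by blast

lemma smooth_on_const: "smooth_on S (\<lambda>x. c)"
  by (simp add: smooth_on_def Ck_on_const)

lemma smooth_on_bounded_linear: "open S \<Longrightarrow> bounded_linear f \<Longrightarrow> smooth_on S f"
  by (simp add: smooth_on_def Ck_on_bounded_linear)

lemma smooth_on_add:
  "open S \<Longrightarrow> smooth_on S f \<Longrightarrow> smooth_on S g \<Longrightarrow> smooth_on S (\<lambda>x. f x + g x)"
  by (simp add: smooth_on_def Ck_on_add)

lemma smooth_on_mult:
  fixes f g :: "'a::real_normed_vector \<Rightarrow> real"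
  shows "open S \<Longrightarrow> smooth_on S f \<Longrightarrow> smooth_on S g \<Longrightarrow> smooth_on S (\<lambda>x. f x * g x)"
  by (simp add: smooth_on_def Ck_on_mult)

lemma smooth_on_inverse:
  fixes f :: "'a::real_normed_vector \<Rightarrow> real"
  shows "open S \<Longrightarrow> smooth_on S f \<Longrightarrow> (\<And>x. x \<in> S \<Longrightarrow> f x \<noteq> 0) \<Longrightarrow> smooth_on S (\<lambda>x. inverse (f x))"
  by (simp add: smooth_on_def Ck_on_inverse)

lemma smooth_on_diff:
  fixes f g :: "'a::real_normed_vector \<Rightarrow> real"
  assumes "open S" "smooth_on S f" "smooth_on S g"
  shows "smooth_on S (\<lambda>x. f x - g x)"
  using smooth_on_add[OF assms(1,2) smooth_on_mult[OF assms(1) smooth_on_const assms(3), of "- 1"]]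
  by simp

lemma smooth_on_divide:
  fixes f g :: "'a::real_normed_vector \<Rightarrow> real"
  assumes "open S" "smooth_on S f" "smooth_on S g" "\<And>x. x \<in> S \<Longrightarrow> g x \<noteq> 0"
  shows "smooth_on S (\<lambda>x. f x / g x)"
  unfolding divide_inverse
  using assms by (intro smooth_on_mult smooth_on_inverse)

lemma smooth_on_sum:
  assumes "open S" "\<And>i. i \<in> I \<Longrightarrow> smooth_on S (f i)"
  shows "smooth_on S (\<lambda>x. \<Sum>i\<in>I. f i x)"
  using assms(2)
proof (induction I rule: infinite_finite_induct)
  case (insert i I)
  then show ?case
    by (simp add: smooth_on_add assms(1))
qed (simp_all add: smooth_on_const)

lemma smooth_on_prod:
  fixes f :: "'i \<Rightarrow> 'a::real_normed_vector \<Rightarrow> real"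
  assumes "open S" "\<And>i. i \<in> I \<Longrightarrow> smooth_on S (f i)"
  shows "smooth_on S (\<lambda>x. \<Prod>i\<in>I. f i x)"
  using assms(2)
proof (induction I rule: infinite_finite_induct)
  case (insert i I)
  then show ?case
    by (simp add: smooth_on_mult assms(1))
qed (simp_all add: smooth_on_const)

lemma smooth_on_power2:
  fixes f :: "'a::real_normed_vector \<Rightarrow> real"
  shows "open S \<Longrightarrow> smooth_on S f \<Longrightarrow> smooth_on S (\<lambda>x. (f x)\<^sup>2)"
  unfolding power2_eq_square by (rule smooth_on_mult)

lemma smooth_on_frechet_derivative:
  "smooth_on S f \<Longrightarrow> smooth_on S (\<lambda>x. frechet_derivative f (at x) v)"
  unfolding smooth_on_def by (blast dest: Ck_on.simps(2)[THEN iffD1])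

lemma smooth_on_has_derivative:
  "smooth_on S f \<Longrightarrow> x \<in> S \<Longrightarrow> (f has_derivative frechet_derivative f (at x)) (at x)"
  unfolding smooth_on_def using Ck_on_Suc_has_derivative by blast

lemma smooth_on_differentiable: "smooth_on S f \<Longrightarrow> x \<in> S \<Longrightarrow> f differentiable (at x)"
  using smooth_on_has_derivative differentiable_def by blast

lemma smooth_on_continuous_on: "smooth_on S f \<Longrightarrow> continuous_on S f"
  unfolding smooth_on_def by (blast dest: Ck_on.simps(1)[THEN iffD1])

lemma smooth_on_det:
  fixes M :: "'a::real_normed_vector \<Rightarrow> real^'n^'n"
  assumes "open S" "\<And>i j. smooth_on S (\<lambda>x. M x $ i $ j)"
  shows "smooth_on S (\<lambda>x. det (M x))"
  unfolding det_def
  by (intro smooth_on_sum smooth_on_mult smooth_on_prod smooth_on_const assms)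

text \<open>By Cramer's rule the entries of the inverse are quotients of determinants, and determinants are
  polynomials in the entries.\<close>

lemma smooth_on_matrix_inv:
  fixes M :: "'a::real_normed_vector \<Rightarrow> real^'n^'n"
  assumes S: "open S" and M: "\<And>i j. smooth_on S (\<lambda>x. M x $ i $ j)"
    and inv: "\<And>x. x \<in> S \<Longrightarrow> invertible (M x)"
  shows "smooth_on S (\<lambda>x. matrix_inv (M x) $ i $ l)"
proof (rule smooth_on_cong[OF S])
  let ?N = "\<lambda>x. (\<chi> r s. if s = i then (axis l 1 :: real^'n) $ r else M x $ r $ s) :: real^'n^'n"
  have "smooth_on S (\<lambda>x. ?N x $ r $ s)" for r s
    by (cases "s = i") (simp_all add: smooth_on_const M)
  then show "smooth_on S (\<lambda>x. det (?N x) / det (M x))"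
    using inv by (intro smooth_on_divide smooth_on_det S M) (auto simp: invertible_det_nz)
  show "det (?N x) / det (M x) = matrix_inv (M x) $ i $ l" if "x \<in> S" for x
  proof -
    have "M x ** matrix_inv (M x) = mat 1"
      using inv[OF that] someI_ex[of "\<lambda>A'. M x ** A' = mat 1 \<and> A' ** M x = mat 1"]
      unfolding invertible_def matrix_inv_def by blast
    then have "M x *v (matrix_inv (M x) *v axis l 1) = axis l 1"
      by (simp add: matrix_vector_mul_assoc)
    then have "matrix_inv (M x) *v axis l 1
        = (\<chi> k. det (\<chi> r s. if s = k then (axis l 1 :: real^'n) $ r else M x $ r $ s) / det (M x))"
      using cramer inv[OF that] invertible_det_nz by blast
    then have "(matrix_inv (M x) *v axis l 1) $ i = det (?N x) / det (M x)"
      by simp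
    then show ?thesis
      by (simp add: matrix_vector_mult_basis column_def)
  qed
qed

lemma directional_mvt:
  fixes f :: "'a::real_normed_vector \<Rightarrow> real"
  assumes s: "s > 0"
    and D: "\<And>t. 0 \<le> t \<Longrightarrow> t \<le> s \<Longrightarrow> (f has_derivative frechet_derivative f (at (z + t *\<^sub>R u))) (at (z + t *\<^sub>R u))"
  shows "\<exists>t. 0 < t \<and> t < s \<and> f (z + s *\<^sub>R u) - f z = s * frechet_derivative f (at (z + t *\<^sub>R u)) u"
proof -
  have d: "((\<lambda>t. f (z + t *\<^sub>R u)) has_derivative (\<lambda>h. h * frechet_derivative f (at (z + t *\<^sub>R u)) u)) (at t)"
    if "0 \<le> t" "t \<le> s" for t
  proof -
    have "((\<lambda>t. z + t *\<^sub>R u) has_derivative (\<lambda>h. h *\<^sub>R u)) (at t)"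
      by (auto intro!: derivative_eq_intros)
    from has_derivative_compose[OF this D[OF that]]
    have "((\<lambda>t. f (z + t *\<^sub>R u)) has_derivative (\<lambda>h. frechet_derivative f (at (z + t *\<^sub>R u)) (h *\<^sub>R u))) (at t)" .
    moreover have "linear (frechet_derivative f (at (z + t *\<^sub>R u)))"
      using D[OF that] has_derivative_linear by blast
    ultimately show ?thesis by (simp add: linear_cmul)
  qed
  have "\<exists>x\<in>{0<..<s}. f (z + s *\<^sub>R u) - f (z + 0 *\<^sub>R u) = (s - 0) * frechet_derivative f (at (z + x *\<^sub>R u)) u"
    by (rule mvt_simple[OF s]) (use d in \<open>auto intro: has_derivative_at_withinI simp: mult.commute\<close>)
  then show ?thesis by auto
qed

text \<open>The mean value theorem, applied to the first difference in direction \<open>v\<close> and then to the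
  \<open>u\<close>-derivative of \<open>f\<close>, turns the second difference over a parallelogram into a second derivative
  at some point of it.\<close>

lemma second_difference_eq:
  fixes f :: "'a::real_normed_vector \<Rightarrow> real"
  assumes f: "smooth_on S f" and s: "s > 0"
    and sub: "\<And>a b. 0 \<le> a \<Longrightarrow> a \<le> s \<Longrightarrow> 0 \<le> b \<Longrightarrow> b \<le> s \<Longrightarrow> z + a *\<^sub>R u + b *\<^sub>R v \<in> S"
  shows "\<exists>a b. 0 < a \<and> a < s \<and> 0 < b \<and> b < s \<and>
    f (z + s *\<^sub>R u + s *\<^sub>R v) - f (z + s *\<^sub>R u) - f (z + s *\<^sub>R v) + f z =
    s * s * frechet_derivative (\<lambda>w. frechet_derivative f (at w) u) (at (z + a *\<^sub>R u + b *\<^sub>R v)) v"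
proof -
  let ?D = "\<lambda>w. frechet_derivative f (at w)"
  let ?h = "\<lambda>w. f (w + s *\<^sub>R v) - f w"
  have Dh: "(?h has_derivative (\<lambda>e. ?D (w + s *\<^sub>R v) e - ?D w e)) (at w)"
    if "w \<in> S" "w + s *\<^sub>R v \<in> S" for w
  proof -
    have "((\<lambda>w. w + s *\<^sub>R v) has_derivative (\<lambda>e. e)) (at w)"
      by (auto intro!: derivative_eq_intros)
    from has_derivative_diff[OF has_derivative_compose[OF this smooth_on_has_derivative[OF f that(2)]]
        smooth_on_has_derivative[OF f that(1)]]
    show ?thesis .
  qed
  have S1: "z + t *\<^sub>R u \<in> S" "z + t *\<^sub>R u + s *\<^sub>R v \<in> S" if "0 \<le> t" "t \<le> s" for t
    using sub[of t 0] sub[of t s] that s by auto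
  have Fh: "frechet_derivative ?h (at (z + t *\<^sub>R u))
      = (\<lambda>e. ?D (z + t *\<^sub>R u + s *\<^sub>R v) e - ?D (z + t *\<^sub>R u) e)" if "0 \<le> t" "t \<le> s" for t
    using frechet_derivative_at[OF Dh[OF S1[OF that]]] by simp
  have "\<exists>a. 0 < a \<and> a < s \<and> ?h (z + s *\<^sub>R u) - ?h z = s * frechet_derivative ?h (at (z + a *\<^sub>R u)) u"
  proof (rule directional_mvt[OF s])
    fix t assume t: "0 \<le> t" "t \<le> s"
    show "(?h has_derivative frechet_derivative ?h (at (z + t *\<^sub>R u))) (at (z + t *\<^sub>R u))"
      unfolding Fh[OF t] by (rule Dh[OF S1[OF t]])
  qed
  then obtain a where a: "0 < a" "a < s"
    and eq0: "?h (z + s *\<^sub>R u) - ?h z = s * frechet_derivative ?h (at (z + a *\<^sub>R u)) u"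
    by blast
  have eq1: "?h (z + s *\<^sub>R u) - ?h z = s * (?D (z + a *\<^sub>R u + s *\<^sub>R v) u - ?D (z + a *\<^sub>R u) u)"
    unfolding eq0 using Fh[of a] a by simp
  have "\<exists>b. 0 < b \<and> b < s \<and> ?D (z + a *\<^sub>R u + s *\<^sub>R v) u - ?D (z + a *\<^sub>R u) u
      = s * frechet_derivative (\<lambda>w. ?D w u) (at (z + a *\<^sub>R u + b *\<^sub>R v)) v"
    by (rule directional_mvt[OF s], rule smooth_on_has_derivative[OF smooth_on_frechet_derivative[OF f]])
      (use sub a in auto)
  then obtain b where "0 < b" "b < s" "?D (z + a *\<^sub>R u + s *\<^sub>R v) u - ?D (z + a *\<^sub>R u) u
      = s * frechet_derivative (\<lambda>w. ?D w u) (at (z + a *\<^sub>R u + b *\<^sub>R v)) v"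
    by blast
  note b = this
  have "f (z + s *\<^sub>R u + s *\<^sub>R v) - f (z + s *\<^sub>R u) - f (z + s *\<^sub>R v) + f z
      = ?h (z + s *\<^sub>R u) - ?h z"
    by simp
  also have "\<dots> = s * s * frechet_derivative (\<lambda>w. ?D w u) (at (z + a *\<^sub>R u + b *\<^sub>R v)) v"
    unfolding eq1 b(3) by simp
  finally show ?thesis
    using a b(1,2) by blast
qed

text \<open>The second difference is symmetric in \<open>u\<close> and \<open>v\<close>. On arbitrarily small parallelograms it
  thus represents both iterated derivatives at points near \<open>z\<close>, and their continuity gives equality at
  \<open>z\<close>.\<close>

lemma second_derivative_commute:
  fixes f :: "'a::real_normed_vector \<Rightarrow> real"
  assumes S: "open S" and f: "smooth_on S f" and z: "z \<in> S"
  shows "frechet_derivative (\<lambda>w. frechet_derivative f (at w) u) (at z) v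
       = frechet_derivative (\<lambda>w. frechet_derivative f (at w) v) (at z) u"
    (is "?P z = ?Q z")
proof (rule ccontr)
  assume ne: "?P z \<noteq> ?Q z"
  define e where "e = \<bar>?P z - ?Q z\<bar> / 2"
  have e: "e > 0" using ne by (simp add: e_def)
  have contP: "continuous_on S ?P" and contQ: "continuous_on S ?Q"
    by (intro smooth_on_continuous_on smooth_on_frechet_derivative f)+
  obtain d1 where d1: "d1 > 0" "\<And>w. w \<in> S \<Longrightarrow> dist w z < d1 \<Longrightarrow> dist (?P w) (?P z) < e"
    using contP z e unfolding continuous_on_iff by blast
  obtain d2 where d2: "d2 > 0" "\<And>w. w \<in> S \<Longrightarrow> dist w z < d2 \<Longrightarrow> dist (?Q w) (?Q z) < e"
    using contQ z e unfolding continuous_on_iff by blast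
  obtain d3 where d3: "d3 > 0" "\<And>w. dist w z < d3 \<Longrightarrow> w \<in> S"
    using S z unfolding open_dist by blast
  define d where "d = min d1 (min d2 d3)"
  have d: "d > 0" using d1 d2 d3 by (simp add: d_def)
  \<comment> \<open>The side length for which the whole parallelogram lies within distance \<open>d\<close> of \<open>z\<close>.\<close>
  define s where "s = d / (norm u + norm v + 1)"
  have pos: "norm u + norm v + 1 > 0" by (simp add: add_nonneg_pos)
  have s: "s > 0" using d pos by (simp add: s_def)
  have close: "dist (z + a *\<^sub>R u + b *\<^sub>R v) z < d" if "0 \<le> a" "a \<le> s" "0 \<le> b" "b \<le> s" for a b
  proof -
    have "norm (a *\<^sub>R u + b *\<^sub>R v) \<le> norm (a *\<^sub>R u) + norm (b *\<^sub>R v)" by (rule norm_triangle_ineq)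
    also have "\<dots> = a * norm u + b * norm v" using that by simp
    also have "\<dots> \<le> s * norm u + s * norm v"
      using that by (intro add_mono mult_right_mono) auto
    also have "\<dots> < s * (norm u + norm v + 1)"
      using s by (simp add: algebra_simps)
    also have "\<dots> = d" using pos by (simp add: s_def)
    finally show ?thesis by (simp add: dist_norm add.assoc)
  qed
  have sub: "z + a *\<^sub>R u + b *\<^sub>R v \<in> S" if "0 \<le> a" "a \<le> s" "0 \<le> b" "b \<le> s" for a b
    using close[OF that] d3 by (simp add: d_def)
  obtain a b where ab: "0 < a" "a < s" "0 < b" "b < s" and
    1: "f (z + s *\<^sub>R u + s *\<^sub>R v) - f (z + s *\<^sub>R u) - f (z + s *\<^sub>R v) + f z
      = s * s * ?P (z + a *\<^sub>R u + b *\<^sub>R v)"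
    using second_difference_eq[OF f s sub] by blast
  have sub': "z + b *\<^sub>R v + a *\<^sub>R u \<in> S" if "0 \<le> b" "b \<le> s" "0 \<le> a" "a \<le> s" for a b
    using sub[OF that(3,4,1,2)] by (simp add: algebra_simps)
  obtain b' a' where ab': "0 < b'" "b' < s" "0 < a'" "a' < s" and
    2: "f (z + s *\<^sub>R v + s *\<^sub>R u) - f (z + s *\<^sub>R v) - f (z + s *\<^sub>R u) + f z
      = s * s * ?Q (z + b' *\<^sub>R v + a' *\<^sub>R u)"
    using second_difference_eq[OF f s sub'] by blast
  have "s * s * ?P (z + a *\<^sub>R u + b *\<^sub>R v) = s * s * ?Q (z + a' *\<^sub>R u + b' *\<^sub>R v)"
    using 1 2 by (simp add: algebra_simps)
  then have eq: "?P (z + a *\<^sub>R u + b *\<^sub>R v) = ?Q (z + a' *\<^sub>R u + b' *\<^sub>R v)"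
    using s by simp
  have "dist (?P (z + a *\<^sub>R u + b *\<^sub>R v)) (?P z) < e"
    using ab by (intro d1 sub order_less_le_trans[OF close]) (auto simp: d_def)
  moreover have "dist (?Q (z + a' *\<^sub>R u + b' *\<^sub>R v)) (?Q z) < e"
    using ab' by (intro d2 sub order_less_le_trans[OF close]) (auto simp: d_def)
  ultimately show False
    using eq dist_triangle_half_l[of "?P z" "?P (z + a *\<^sub>R u + b *\<^sub>R v)" "2 * e" "?Q z"]
    by (simp add: dist_commute) (simp add: dist_real_def e_def)
qed

section \<open>The mean Berwald curvature in coordinates\<close>

text \<open>A derivative in \<open>y\<close> only sees the values over the same base point. This makes it possible to
  differentiate identities that hold for a single \<open>x\<close>, such as those with the coefficients \<open>b\<^sub>i(x)\<close>
  kept constant.\<close>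

lemma dy_const_on_fibre:
  assumes f: "f differentiable (at (x, y))" and V: "open V" "y \<in> V"
    and const: "\<And>w. w \<in> V \<Longrightarrow> f (x, w) = c"
  shows "dy i f (x, y) = 0"
proof -
  let ?D = "frechet_derivative f (at (x, y))"
  have "((\<lambda>w. (x, w)) has_derivative (\<lambda>h. (0, h))) (at y)"
    by (auto intro!: derivative_eq_intros)
  from has_derivative_compose[OF this f[unfolded frechet_derivative_works]]
  have "((\<lambda>w. f (x, w)) has_derivative (\<lambda>h. ?D (0, h))) (at y)" .
  then have "((\<lambda>w. c) has_derivative (\<lambda>h. ?D (0, h))) (at y)"
    by (rule has_derivative_transform_within_open[OF _ V]) (rule const)
  then have "(\<lambda>h. ?D (0, h)) = (\<lambda>h. 0)"
    using has_derivative_unique has_derivative_const by blast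
  then show ?thesis
    unfolding dy_def by (rule fun_cong)
qed

lemma dy_sum_mult:
  assumes "\<And>h. h \<in> I \<Longrightarrow> f h differentiable (at z)" "\<And>h. h \<in> I \<Longrightarrow> g h differentiable (at z)"
  shows "dy i (\<lambda>z. \<Sum>h\<in>I. f h z * g h z) z = (\<Sum>h\<in>I. f h z * dy i (g h) z + dy i (f h) z * g h z)"
proof -
  have "((\<lambda>z. \<Sum>h\<in>I. f h z * g h z) has_derivative (\<lambda>v. \<Sum>h\<in>I.
      f h z * frechet_derivative (g h) (at z) v + frechet_derivative (f h) (at z) v * g h z)) (at z)"
    by (intro has_derivative_sum has_derivative_mult assms[unfolded frechet_derivative_works])
  from fun_cong[OF frechet_derivative_at[OF this], of "(0, axis i 1)"] show ?thesis
    unfolding dy_def by (rule sym)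
qed

lemma smooth_on_dx: "smooth_on S f \<Longrightarrow> smooth_on S (dx i f)"
  unfolding dx_def by (rule smooth_on_frechet_derivative)

lemma smooth_on_dy: "smooth_on S f \<Longrightarrow> smooth_on S (dy i f)"
  unfolding dy_def by (rule smooth_on_frechet_derivative)

lemma dy_commute: "open S \<Longrightarrow> smooth_on S f \<Longrightarrow> z \<in> S \<Longrightarrow> dy i (dy j f) z = dy j (dy i f) z"
  unfolding dy_def by (rule second_derivative_commute)

lemma invertible_iff_rank: "invertible M \<longleftrightarrow> rank M = CARD('n)" for M :: "real^'n^'n"
  unfolding full_rank_injective invertible_left_inverse matrix_left_invertible_injective ..

lemma smooth_on_spray:
  fixes F :: "(real^'n::finite) \<times> (real^'n) \<Rightarrow> real"
  assumes S: "open S" and F: "smooth_on S F"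
    and rank: "\<And>z. z \<in> S \<Longrightarrow> rank (metric_tensor F z) = CARD('n)"
  shows "smooth_on S (spray F i)"
proof -
  have F2: "smooth_on S (\<lambda>w. (F w)\<^sup>2)"
    by (rule smooth_on_power2[OF S F])
  have "smooth_on S (\<lambda>z. metric_tensor F z $ r $ s)" for r s
    unfolding metric_tensor_def
    by (simp, intro smooth_on_dy smooth_on_divide S F2 smooth_on_const) simp
  then have g: "smooth_on S (\<lambda>z. matrix_inv (metric_tensor F z) $ i $ l)" for l
    by (intro smooth_on_matrix_inv S) (simp_all add: invertible_iff_rank rank)
  have "bounded_linear (\<lambda>z :: (real^'n) \<times> (real^'n). snd z $ k)" for k
    by (rule bounded_linear_compose[OF bounded_linear_vec_nth bounded_linear_snd])
  then have "smooth_on S (\<lambda>z. snd z $ k)" for k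
    by (rule smooth_on_bounded_linear[OF S])
  then show ?thesis
    unfolding spray_def
    by (intro smooth_on_mult smooth_on_sum smooth_on_diff smooth_on_const smooth_on_dx smooth_on_dy S F2 g)
qed

lemma smooth_on_berwald_conn:
  fixes F :: "(real^'n::finite) \<times> (real^'n) \<Rightarrow> real"
  assumes "open S" "smooth_on S F" "\<And>z. z \<in> S \<Longrightarrow> rank (metric_tensor F z) = CARD('n)"
  shows "smooth_on S (berwald_conn F h i j)"
  unfolding berwald_conn_def nonlinear_conn_def
  by (intro smooth_on_dy smooth_on_spray assms)

text \<open>The rows of a matrix are orthogonal to its kernel.\<close>

lemma rank_le_if_two_kernel_vectors:
  fixes M :: "real^'n^'m"
  assumes "independent {u, v}" "u \<noteq> v" "M *v u = 0" "M *v v = 0"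
  shows "rank M \<le> CARD('n) - 2"
proof -
  let ?K = "span {u, v}"
  have "M *v x = 0" if "x \<in> ?K" for x
    using that
  proof (induction rule: span_induct)
    case base
    then show ?case
      by (auto simp: subspace_def matrix_vector_right_distrib matrix_vector_mult_scaleR)
  qed (use assms in auto)
  then have "rows M \<subseteq> {y \<in> UNIV. \<forall>x\<in>?K. orthogonal x y}"
    using orthogonal_nullspace_rowspace span_base by blast
  then have "dim (rows M) \<le> dim {y \<in> UNIV. \<forall>x\<in>?K. orthogonal x y}"
    by (rule dim_subset)
  moreover have "dim {y \<in> UNIV. \<forall>x\<in>?K. orthogonal x y} + dim ?K = dim (UNIV :: (real^'n) set)"
    by (rule dim_subspace_orthogonal_to_vectors) auto
  moreover have "dim ?K = 2"
    using assms(1,2) by (simp add: dim_eq_card_independent)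
  ultimately show ?thesis
    by (simp add: row_rank_def)
qed

text \<open>For homogeneous \<open>F\<close> this is the covector \<open>p\<^sub>h = g\<^sub>h\<^sub>i y\<^sup>i\<close> metrically dual to \<open>y\<close>; written as
  a derivative of the energy, it has the metric as its own derivative by definition.\<close>

definition energy_covector ::
  "((real^'n::finite) \<times> (real^'n) \<Rightarrow> real) \<Rightarrow> 'n \<Rightarrow> (real^'n) \<times> (real^'n) \<Rightarrow> real" where
  "energy_covector F h = dy h (\<lambda>w. (F w)\<^sup>2 / 2)"

lemma metric_tensor_eq_dy_energy_covector:
  "metric_tensor F z $ m $ h = dy m (energy_covector F h) z"
  by (simp add: metric_tensor_def energy_covector_def)

lemma smooth_on_energy_covector:
  "open S \<Longrightarrow> smooth_on S F \<Longrightarrow> smooth_on S (energy_covector F h)"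
  unfolding energy_covector_def
  by (intro smooth_on_dy smooth_on_divide smooth_on_power2 smooth_on_const) auto

lemma energy_covector_eq:
  assumes "F differentiable (at z)"
  shows "energy_covector F h z = F z * dy h F z"
proof -
  have "((\<lambda>w. (F w)\<^sup>2 / 2) has_derivative (\<lambda>v. F z * frechet_derivative F (at z) v)) (at z)"
    using assms[unfolded frechet_derivative_works]
    by (auto intro!: derivative_eq_intros)
  from fun_cong[OF frechet_derivative_at[OF this], of "(0, axis h 1)"] show ?thesis
    unfolding energy_covector_def dy_def by (rule sym)
qed

lemma energy_covector_annihilates_berwald_curv:
  assumes "F differentiable (at z)" "F z \<noteq> 0" "landsberg_curv F i j k z = 0"
  shows "(\<Sum>h\<in>UNIV. energy_covector F h z * berwald_curv F h i j k z) = 0"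
proof -
  have "(\<Sum>h\<in>UNIV. berwald_curv F h i j k z * dy h F z) = 0"
    using assms(2,3) by (simp add: landsberg_curv_def)
  moreover have "(\<Sum>h\<in>UNIV. energy_covector F h z * berwald_curv F h i j k z)
      = F z * (\<Sum>h\<in>UNIV. berwald_curv F h i j k z * dy h F z)"
    by (simp add: energy_covector_eq[OF assms(1)] sum_distrib_left algebra_simps)
  ultimately show ?thesis by simp
qed

text \<open>The index lowered by the metric can be exchanged with the last index of \<open>G\<^sup>h\<^sub>i\<^sub>j\<^sub>k\<close>: the
  derivative in \<open>y\<^sup>m\<close> of the Landsberg condition \<open>p\<^sub>h G\<^sup>h\<^sub>i\<^sub>j\<^sub>k = 0\<close> expresses the lowered curvature
  through a second derivative of \<open>G\<^sup>h\<^sub>i\<^sub>j\<close> in \<open>y\<^sup>m\<close> and \<open>y\<^sup>k\<close>.\<close>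

lemma landsberg_berwald_curv_swap:
  fixes F :: "(real^'n::finite) \<times> (real^'n) \<Rightarrow> real"
  assumes S: "open S" and F: "smooth_on S F"
    and rank: "\<And>z. z \<in> S \<Longrightarrow> rank (metric_tensor F z) = CARD('n)"
    and p: "\<And>z i j k. z \<in> S \<Longrightarrow> (\<Sum>h\<in>UNIV. energy_covector F h z * berwald_curv F h i j k z) = 0"
    and z: "z \<in> S"
  shows "(\<Sum>h\<in>UNIV. metric_tensor F z $ m $ h * berwald_curv F h i j k z)
       = (\<Sum>h\<in>UNIV. metric_tensor F z $ k $ h * berwald_curv F h i j m z)"
proof -
  have C: "smooth_on S (berwald_conn F h i j)" for h
    by (rule smooth_on_berwald_conn[OF S F rank])
  have B: "smooth_on S (berwald_curv F h i j k)" for h k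
    unfolding berwald_curv_def by (rule smooth_on_dy[OF C])
  have expand: "(\<Sum>h\<in>UNIV. metric_tensor F z $ m $ h * berwald_curv F h i j k z)
      = - (\<Sum>h\<in>UNIV. energy_covector F h z * dy m (dy k (berwald_conn F h i j)) z)" for m k
  proof -
    let ?f = "\<lambda>z. \<Sum>h\<in>UNIV. energy_covector F h z * berwald_curv F h i j k z"
    have "?f differentiable (at z)"
      by (intro smooth_on_differentiable[OF _ z] smooth_on_sum smooth_on_mult S B
          smooth_on_energy_covector F)
    then have "frechet_derivative ?f (at z) = frechet_derivative (\<lambda>z. 0) (at z)"
      by (rule frechet_derivative_transform_within_open[OF _ S z]) (rule p)
    then have "dy m ?f z = 0"
      by (simp add: dy_def)
    moreover have "dy m ?f z = (\<Sum>h\<in>UNIV. energy_covector F h z * dy m (berwald_curv F h i j k) z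
        + dy m (energy_covector F h) z * berwald_curv F h i j k z)"
      by (intro dy_sum_mult smooth_on_differentiable[OF _ z] B smooth_on_energy_covector S F)
    ultimately have "(\<Sum>h\<in>UNIV. energy_covector F h z * dy m (berwald_curv F h i j k) z)
        + (\<Sum>h\<in>UNIV. dy m (energy_covector F h) z * berwald_curv F h i j k z) = 0"
      by (simp only: sum.distrib)
    then show ?thesis
      unfolding metric_tensor_eq_dy_energy_covector berwald_curv_def by linarith
  qed
  show ?thesis
    unfolding expand by (intro arg_cong[of _ _ uminus] sum.cong refl arg_cong2[of _ _ _ _ "(*)"] dy_commute[OF S C z])
qed

text \<open>If the metric dual of \<open>u\<close> annihilates the upper index, the exchange of indices gives
  \<open>g\<^sub>m\<^sub>h G\<^sup>h\<^sub>i\<^sub>j\<^sub>k u\<^sup>k = u\<^sup>k g\<^sub>k\<^sub>h G\<^sup>h\<^sub>i\<^sub>j\<^sub>m = 0\<close>. As the metric is invertible, contracting the last index of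
  the Berwald curvature with \<open>u\<close> yields zero even before the trace is taken.\<close>

lemma mean_berwald_kernel:
  fixes F :: "(real^'n::finite) \<times> (real^'n) \<Rightarrow> real"
  assumes g: "invertible (metric_tensor F z)"
    and swap: "\<And>i j k m. (\<Sum>h\<in>UNIV. metric_tensor F z $ m $ h * berwald_curv F h i j k z)
       = (\<Sum>h\<in>UNIV. metric_tensor F z $ k $ h * berwald_curv F h i j m z)"
    and a: "\<And>i j k. (\<Sum>h\<in>UNIV. (u v* metric_tensor F z) $ h * berwald_curv F h i j k z) = 0"
  shows "mean_berwald F z *v u = 0"
proof -
  let ?g = "metric_tensor F z" and ?B = "\<lambda>h i j k. berwald_curv F h i j k z"
  have contr: "(\<Sum>k\<in>UNIV. ?B h i j k * u $ k) = 0" for h i j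
  proof -
    let ?w = "\<chi> h. \<Sum>k\<in>UNIV. ?B h i j k * u $ k"
    have "(?g *v ?w) $ m = 0" for m
    proof -
      have "(?g *v ?w) $ m = (\<Sum>k\<in>UNIV. (\<Sum>h\<in>UNIV. ?g $ m $ h * ?B h i j k) * u $ k)"
        by (simp add: matrix_vector_mult_def sum_distrib_left sum_distrib_right mult.assoc)
          (rule sum.swap)
      also have "\<dots> = (\<Sum>k\<in>UNIV. (\<Sum>h\<in>UNIV. ?g $ k $ h * ?B h i j m) * u $ k)"
        by (subst swap) (rule refl)
      also have "\<dots> = (\<Sum>h\<in>UNIV. (u v* ?g) $ h * ?B h i j m)"
        unfolding sum_distrib_right vector_matrix_mult_def
        by (subst sum.swap) (simp add: sum_distrib_left algebra_simps)
      finally show ?thesis by (simp add: a)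
    qed
    then have "?g *v ?w = 0" by (simp add: vec_eq_iff)
    then have "?w = 0"
      using g matrix_left_invertible_ker invertible_left_inverse by blast
    then show ?thesis by (simp add: vec_eq_iff)
  qed
  have "(mean_berwald F z *v u) $ j = 1/2 * (\<Sum>i\<in>UNIV. \<Sum>k\<in>UNIV. ?B i i j k * u $ k)" for j
    by (simp add: mean_berwald_def matrix_vector_mult_def sum_distrib_right sum_divide_distrib)
      (rule sum.swap)
  then show ?thesis by (simp add: vec_eq_iff contr)
qed

text \<open>The local form of the theorem, for a covector \<open>b\<close> at a single base point \<open>x\<close> that annihilates the
  curvature for all \<open>y\<close> near the given one. Where \<open>p\<close> is not a multiple of \<open>b\<close>, the vectors dual
  to \<open>p\<close> and \<open>b\<close> are independent elements of the kernel; where it is, the curvature itself is zero.\<close>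

lemma landsberg_rank_mean_berwald:
  fixes F :: "(real^'n::finite) \<times> (real^'n) \<Rightarrow> real" and b :: "real^'n"
  assumes S: "open S" and F: "smooth_on S F"
    and rank: "\<And>z. z \<in> S \<Longrightarrow> rank (metric_tensor F z) = CARD('n)"
    and p: "\<And>z i j k. z \<in> S \<Longrightarrow> (\<Sum>h\<in>UNIV. energy_covector F h z * berwald_curv F h i j k z) = 0"
    and V: "open V" "y \<in> V" "{x} \<times> V \<subseteq> S"
    and b: "\<And>w i j k. w \<in> V \<Longrightarrow> (\<Sum>h\<in>UNIV. b $ h * berwald_curv F h i j k (x, w)) = 0"
    and b0: "b \<noteq> 0"
  shows "rank (mean_berwald F (x, y)) \<le> CARD('n) - 2"
proof -
  let ?z = "(x, y)"
  let ?g = "metric_tensor F ?z"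
  have z: "?z \<in> S" using V by auto
  have g: "invertible ?g"
    using rank[OF z] by (simp add: invertible_iff_rank)
  define P where "P = (\<chi> h. energy_covector F h ?z)"
  show ?thesis
  proof (cases "\<exists>\<mu>. P = \<mu> *\<^sub>R b")
    case True
    then obtain \<mu> where \<mu>: "P = \<mu> *\<^sub>R b" ..
    have B: "berwald_curv F h i j k ?z = 0" for h i j k
    proof -
      have C: "smooth_on S (berwald_curv F h i j k)" for h
        unfolding berwald_curv_def by (rule smooth_on_dy[OF smooth_on_berwald_conn[OF S F rank]])
      \<comment> \<open>\<open>\<mu>\<close> and \<open>b\<close> stay fixed while \<open>y\<close> varies, so that \<open>q\<close> has the derivative of \<open>p\<close>, that is
         the metric, and the value zero at the point itself.\<close>
      let ?q = "\<lambda>h z. energy_covector F h z - \<mu> * b $ h"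
      have q: "smooth_on S (?q h)" for h
        by (intro smooth_on_diff smooth_on_energy_covector S F smooth_on_const)
      have q0: "?q h ?z = 0" for h
        using \<mu> by (simp add: P_def vec_eq_iff)
      have dq: "dy m (?q h) ?z = dy m (energy_covector F h) ?z" for m h
      proof -
        have "(?q h has_derivative (\<lambda>v. frechet_derivative (energy_covector F h) (at ?z) v - 0)) (at ?z)"
          by (intro has_derivative_diff has_derivative_const
              smooth_on_has_derivative[OF smooth_on_energy_covector[OF S F] z])
        from fun_cong[OF frechet_derivative_at[OF this], of "(0, axis m 1)"] show ?thesis
          by (simp add: dy_def)
      qed
      let ?f = "\<lambda>z. \<Sum>h\<in>UNIV. ?q h z * berwald_curv F h i j k z"
      have "(?g *v (\<chi> h. berwald_curv F h i j k ?z)) $ m = 0" for m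
      proof -
        have "dy m ?f ?z = 0"
        proof (rule dy_const_on_fibre[OF _ V(1,2)])
          show "?f differentiable (at ?z)"
            by (intro smooth_on_differentiable[OF _ z] smooth_on_sum smooth_on_mult S q C)
          show "?f (x, w) = 0" if "w \<in> V" for w
          proof -
            have "?f (x, w) = (\<Sum>h\<in>UNIV. energy_covector F h (x, w) * berwald_curv F h i j k (x, w))
                - \<mu> * (\<Sum>h\<in>UNIV. b $ h * berwald_curv F h i j k (x, w))"
              by (simp add: left_diff_distrib sum_subtractf sum_distrib_left mult.assoc)
            then show ?thesis using p[of "(x, w)"] b[OF that] V(3) that by auto
          qed
        qed
        moreover have "dy m ?f ?z = (\<Sum>h\<in>UNIV. ?q h ?z * dy m (berwald_curv F h i j k) ?z
            + dy m (?q h) ?z * berwald_curv F h i j k ?z)"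
          by (intro dy_sum_mult smooth_on_differentiable[OF _ z] q C)
        ultimately show ?thesis
          by (simp add: q0 dq[simplified] matrix_vector_mult_def metric_tensor_eq_dy_energy_covector)
      qed
      then have "?g *v (\<chi> h. berwald_curv F h i j k ?z) = 0"
        by (simp add: vec_eq_iff)
      then have "(\<chi> h. berwald_curv F h i j k ?z) = 0"
        using g matrix_left_invertible_ker invertible_left_inverse by blast
      then show ?thesis by (simp add: vec_eq_iff)
    qed
    then have "mean_berwald F ?z = 0"
      by (simp add: mean_berwald_def vec_eq_iff)
    then show ?thesis by simp
  next
    case False
    have gT: "invertible (transpose ?g)"
      using g by (simp add: invertible_iff_rank rank_transpose)
    then obtain u v where u: "u v* ?g = P" and v: "v v* ?g = b"
      by (metis invertible_right_inverse matrix_right_invertible_surjective surjD transpose_matrix_vector)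
    have ker: "mean_berwald F ?z *v w = 0"
      if "\<And>i j k. (\<Sum>h\<in>UNIV. (w v* ?g) $ h * berwald_curv F h i j k ?z) = 0" for w
      by (rule mean_berwald_kernel[OF g landsberg_berwald_curv_swap[OF S F rank p z] that])
    have ku: "mean_berwald F ?z *v u = 0"
      by (rule ker) (simp add: u P_def p[OF z])
    have kv: "mean_berwald F ?z *v v = 0"
      by (rule ker) (simp add: v b[OF V(2)])
    have "u \<notin> span {v}"
    proof
      assume "u \<in> span {v}"
      then obtain c where "u = c *\<^sub>R v" by (auto simp: span_singleton)
      then have "P = c *\<^sub>R b"
        using u v by (metis matrix_vector_mult_scaleR transpose_matrix_vector)
      then show False using False by blast
    qed
    moreover have "v \<noteq> 0" using v b0 by auto
    ultimately have "independent {u, v}" "u \<noteq> v"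
      by (auto simp: independent_insert span_base)
    then show ?thesis
      by (rule rank_le_if_two_kernel_vectors[OF _ _ ku kv])
  qed
qed

section \<open>Uniqueness for linear total differential systems\<close>

text \<open>On a ball of radius \<open>d\<close> with \<open>C d \<le> 1/2\<close> the mean value inequality bounds the maximum of
  \<open>norm f\<close> by half of itself.\<close>

lemma zero_near_if_derivative_bounded_by_value:
  fixes f :: "'a::euclidean_space \<Rightarrow> 'b::real_normed_vector"
  assumes r: "r > 0" and C: "C \<ge> 0"
    and deriv: "\<And>x. x \<in> cball x0 r \<Longrightarrow> (f has_derivative f' x) (at x)"
    and bound: "\<And>x. x \<in> cball x0 r \<Longrightarrow> onorm (f' x) \<le> C * norm (f x)"
    and zero: "f x0 = 0"
  shows "\<exists>e>0. e \<le> r \<and> (\<forall>x\<in>ball x0 e. f x = 0)"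
proof -
  \<comment> \<open>\<open>C + 1\<close> instead of \<open>C\<close> avoids dividing by zero.\<close>
  define d where "d = min r (1 / (2 * (C + 1)))"
  have d: "d > 0" "d \<le> r" "C * d \<le> 1 / 2"
  proof -
    show "d > 0" "d \<le> r" using r C by (auto simp: d_def)
    have "C * d \<le> C * (1 / (2 * (C + 1)))"
      using C by (intro mult_left_mono) (auto simp: d_def)
    also have "\<dots> \<le> 1 / 2" using C by (simp add: field_simps)
    finally show "C * d \<le> 1 / 2" .
  qed
  have sub: "cball x0 d \<subseteq> cball x0 r" using d by auto
  have "continuous_on (cball x0 d) f"
    using deriv sub by (meson continuous_at_imp_continuous_on has_derivative_continuous subsetD)
  then have "continuous_on (cball x0 d) (\<lambda>x. norm (f x))"
    by (rule continuous_on_norm)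
  then obtain x1 where x1: "x1 \<in> cball x0 d" and max: "\<And>x. x \<in> cball x0 d \<Longrightarrow> norm (f x) \<le> norm (f x1)"
    using continuous_attains_sup[of "cball x0 d"] d(1) by (metis cball_eq_empty compact_cball not_less order_less_imp_le)
  have "norm (f x1 - f x0) \<le> (C * norm (f x1)) * norm (x1 - x0)"
  proof (rule differentiable_bound[OF convex_cball, of x0 d f f'])
    fix x assume x: "x \<in> cball x0 d"
    show "(f has_derivative f' x) (at x within cball x0 d)"
      using deriv x sub by (blast intro: has_derivative_at_withinI)
    show "onorm (f' x) \<le> C * norm (f x1)"
      using order_trans[OF bound mult_left_mono[OF max[OF x] C]] x sub by blast
  qed (use x1 d in auto)
  also have "\<dots> \<le> (C * norm (f x1)) * d"
    using x1 C by (intro mult_left_mono) (auto simp: dist_norm norm_minus_commute)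
  also have "\<dots> = (C * d) * norm (f x1)" by simp
  also have "\<dots> \<le> 1 / 2 * norm (f x1)"
    using d(3) by (intro mult_right_mono) auto
  finally have "norm (f x1) = 0" using zero by simp
  then have "f x = 0" if "x \<in> ball x0 d" for x
    using max[of x] that by simp
  then show ?thesis using d by blast
qed

text \<open>Uniqueness for a linear total differential system: the coefficients are bounded on a compact
  ball, which bounds the derivative of \<open>b\<close> by a multiple of its value.\<close>

lemma zero_near_if_linear_system:
  fixes b :: "'n::finite \<Rightarrow> real^'n \<Rightarrow> real" and \<Gamma> :: "'n \<Rightarrow> 'n \<Rightarrow> 'n \<Rightarrow> real^'n \<Rightarrow> real"
  assumes U: "open U" "x0 \<in> U" and b: "\<And>i. smooth_on U (b i)"
    and \<Gamma>: "\<And>h i j. continuous_on U (\<Gamma> h i j)"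
    and eq: "\<And>x i j. x \<in> U \<Longrightarrow> frechet_derivative (b i) (at x) (axis j 1) = (\<Sum>h\<in>UNIV. \<Gamma> h i j x * b h x)"
    and zero: "\<And>i. b i x0 = 0"
  shows "\<exists>e>0. ball x0 e \<subseteq> U \<and> (\<forall>x\<in>ball x0 e. \<forall>i. b i x = 0)"
proof -
  obtain r where r: "r > 0" "cball x0 r \<subseteq> U"
    using U open_contains_cball by blast
  define T where "T = (\<lambda>x. \<Sum>i\<in>UNIV. \<Sum>j\<in>UNIV. \<Sum>h\<in>UNIV. \<bar>\<Gamma> h i j x\<bar>)"
  have T0: "T x \<ge> 0" for x
    unfolding T_def by (intro sum_nonneg) auto
  have "continuous_on (cball x0 r) T"
    unfolding T_def
    by (intro continuous_on_sum continuous_on_rabs continuous_on_subset[OF \<Gamma> r(2)])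
  then obtain x1 where x1: "x1 \<in> cball x0 r" and "\<And>x. x \<in> cball x0 r \<Longrightarrow> T x \<le> T x1"
    using continuous_attains_sup[of "cball x0 r" T] r(1) by auto
  note max = this(2)
  define B where "B = (\<lambda>x. \<chi> i. b i x)"
  define B' where "B' = (\<lambda>x v. \<chi> i. frechet_derivative (b i) (at x) v)"
  have deriv: "(B has_derivative B' x) (at x)" if "x \<in> cball x0 r" for x
  proof (subst has_derivative_componentwise_within, intro ballI)
    fix a :: "real^'n" assume "a \<in> Basis"
    then obtain i where i: "a = axis i 1" by (auto simp: Basis_vec_def)
    have "(b i has_derivative frechet_derivative (b i) (at x)) (at x)"
      by (rule smooth_on_has_derivative[OF b]) (use that r in blast)
    then show "((\<lambda>x. B x \<bullet> a) has_derivative (\<lambda>v. B' x v \<bullet> a)) (at x)"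
      by (simp add: B_def B'_def i inner_axis)
  qed
  have bound: "norm (B' x v) \<le> T x * norm (B x) * norm v" if x: "x \<in> U" for x v
  proof -
    have comp: "\<bar>B' x v $ i\<bar> \<le> (\<Sum>j\<in>UNIV. \<Sum>h\<in>UNIV. \<bar>\<Gamma> h i j x\<bar> * norm (B x) * norm v)" for i
    proof -
      have lin: "linear (frechet_derivative (b i) (at x))"
        using smooth_on_has_derivative[OF b x] has_derivative_linear by blast
      have "v = (\<Sum>j\<in>UNIV. v $ j *\<^sub>R axis j 1)"
        using basis_expansion[of v] by (simp add: scalar_mult_eq_scaleR)
      then have "frechet_derivative (b i) (at x) v
          = frechet_derivative (b i) (at x) (\<Sum>j\<in>UNIV. v $ j *\<^sub>R axis j 1)"
        by (rule arg_cong)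
      also have "\<dots> = (\<Sum>j\<in>UNIV. v $ j * frechet_derivative (b i) (at x) (axis j 1))"
        by (simp add: linear_sum[OF lin] linear_cmul[OF lin])
      finally have "B' x v $ i = (\<Sum>j\<in>UNIV. \<Sum>h\<in>UNIV. v $ j * (\<Gamma> h i j x * b h x))"
        by (simp add: B'_def eq[OF x] sum_distrib_left)
      also have "\<bar>\<dots>\<bar> \<le> (\<Sum>j\<in>UNIV. \<Sum>h\<in>UNIV. \<bar>v $ j * (\<Gamma> h i j x * b h x)\<bar>)"
        by (intro order_trans[OF sum_abs] sum_mono order_refl)
      also have "\<dots> \<le> (\<Sum>j\<in>UNIV. \<Sum>h\<in>UNIV. \<bar>\<Gamma> h i j x\<bar> * norm (B x) * norm v)"
      proof (intro sum_mono)
        fix j h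
        have "\<bar>b h x\<bar> \<le> norm (B x)"
          using component_le_norm_cart[of "B x" h] by (simp add: B_def)
        moreover have "\<bar>v $ j\<bar> \<le> norm v" by (rule component_le_norm_cart)
        ultimately have "\<bar>\<Gamma> h i j x\<bar> * \<bar>b h x\<bar> * \<bar>v $ j\<bar> \<le> \<bar>\<Gamma> h i j x\<bar> * norm (B x) * norm v"
          by (intro mult_mono) auto
        then show "\<bar>v $ j * (\<Gamma> h i j x * b h x)\<bar> \<le> \<bar>\<Gamma> h i j x\<bar> * norm (B x) * norm v"
          by (simp add: abs_mult mult.commute)
      qed
      finally show ?thesis .
    qed
    have "norm (B' x v) \<le> (\<Sum>i\<in>UNIV. \<bar>B' x v $ i\<bar>)" by (rule norm_le_l1_cart)
    also have "\<dots> \<le> (\<Sum>i\<in>UNIV. \<Sum>j\<in>UNIV. \<Sum>h\<in>UNIV. \<bar>\<Gamma> h i j x\<bar> * norm (B x) * norm v)"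
      by (intro sum_mono comp)
    also have "\<dots> = T x * norm (B x) * norm v"
      by (simp add: T_def sum_distrib_right)
    finally show ?thesis .
  qed
  have "\<exists>e>0. e \<le> r \<and> (\<forall>x\<in>ball x0 e. B x = 0)"
  proof (rule zero_near_if_derivative_bounded_by_value[OF r(1) T0[of x1] deriv])
    fix x assume x: "x \<in> cball x0 r"
    have "onorm (B' x) \<le> T x * norm (B x)"
      using x r(2) T0 by (intro onorm_bound bound mult_nonneg_nonneg) auto
    also have "\<dots> \<le> T x1 * norm (B x)"
      using max[OF x] by (intro mult_right_mono) auto
    finally show "onorm (B' x) \<le> T x1 * norm (B x)" .
  qed (simp_all add: B_def zero vec_eq_iff)
  then obtain e where e: "e > 0" "e \<le> r" "\<And>x. x \<in> ball x0 e \<Longrightarrow> B x = 0" by blast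
  have "ball x0 e \<subseteq> U" using e(2) r(2) by (auto intro!: subsetD[OF r(2)])
  moreover have "b i x = 0" if "x \<in> ball x0 e" for x i
    using e(3)[OF that] by (simp add: B_def vec_eq_iff)
  ultimately show ?thesis using e(1) by blast
qed

section \<open>Charts and tangent vectors\<close>

lemma is_chartD:
  assumes "is_chart c"
  shows "open (fst c)" "open (chart_image c)" "continuous_on (fst c) (snd c)"
    "continuous_on (chart_image c) (chart_inv c)"
    "p \<in> fst c \<Longrightarrow> snd c p \<in> chart_image c" "p \<in> fst c \<Longrightarrow> chart_inv c (snd c p) = p"
    "x \<in> chart_image c \<Longrightarrow> chart_inv c x \<in> fst c" "x \<in> chart_image c \<Longrightarrow> snd c (chart_inv c x) = x"
proof -
  from assms have h: "homeomorphism (fst c) (chart_image c) (snd c) (chart_inv c)"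
    and "open (fst c)" "open (chart_image c)"
    by (simp_all add: is_chart_def)
  then show "open (fst c)" "open (chart_image c)" by simp_all
  show "continuous_on (fst c) (snd c)" "continuous_on (chart_image c) (chart_inv c)"
    by (rule homeomorphism_cont1[OF h], rule homeomorphism_cont2[OF h])
  show "snd c p \<in> chart_image c" if "p \<in> fst c"
    using that by (simp add: chart_image_def)
  show "chart_inv c (snd c p) = p" if "p \<in> fst c"
    by (rule homeomorphism_apply1[OF h that])
  show "chart_inv c x \<in> fst c" if "x \<in> chart_image c"
    using homeomorphism_image2[OF h] that by blast
  show "snd c (chart_inv c x) = x" if "x \<in> chart_image c"
    by (rule homeomorphism_apply2[OF h that])
qed

lemma open_slit_coords: "is_chart c \<Longrightarrow> open (slit_coords c)"
  unfolding slit_coords_def by (rule open_Times[OF is_chartD(2)]) auto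

text \<open>Written this way, the image of an overlap is visibly open.\<close>

lemma chart_overlap_eq:
  assumes "is_chart c"
  shows "snd c ` (fst c \<inter> fst d) = chart_image c \<inter> chart_inv c -` fst d"
proof (intro equalityI subsetI)
  fix x assume "x \<in> chart_image c \<inter> chart_inv c -` fst d"
  then have "chart_inv c x \<in> fst c \<inter> fst d" "x = snd c (chart_inv c x)"
    using is_chartD(7,8)[OF assms] by auto
  then show "x \<in> snd c ` (fst c \<inter> fst d)" by blast
next
  fix x assume "x \<in> snd c ` (fst c \<inter> fst d)"
  then obtain p where "p \<in> fst c" "p \<in> fst d" "x = snd c p" by blast
  then show "x \<in> chart_image c \<inter> chart_inv c -` fst d"
    using is_chartD(5,6)[OF assms, of p] by simp
qed

lemma open_chart_overlap:
  assumes "is_chart c" "is_chart d"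
  shows "open (snd c ` (fst c \<inter> fst d))"
  unfolding chart_overlap_eq[OF assms(1)]
  by (rule continuous_open_preimage[OF is_chartD(4,2)[OF assms(1)] is_chartD(1)[OF assms(2)]])

lemma transition_has_derivative:
  assumes "smooth_manifold A" "c \<in> A" "d \<in> A" "x \<in> snd c ` (fst c \<inter> fst d)"
  shows "(transition c d has_derivative frechet_derivative (transition c d) (at x)) (at x)"
  by (rule smooth_on_has_derivative[OF _ assms(4)]) (use assms in \<open>simp add: smooth_manifold_def\<close>)

text \<open>The chain rule for the transition maps is the cocycle condition on the Jacobians; it makes the
  coordinate vectors of one chart into tangent vectors of the manifold.\<close>

lemma frechet_derivative_transition_compose:
  assumes M: "smooth_manifold A" and A: "c \<in> A" "d \<in> A" "e \<in> A"
    and p: "p \<in> fst c" "p \<in> fst d" "p \<in> fst e"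
  shows "frechet_derivative (transition c e) (at (snd c p)) y
    = frechet_derivative (transition d e) (at (snd d p)) (frechet_derivative (transition c d) (at (snd c p)) y)"
proof -
  have ch: "is_chart c" "is_chart d" "is_chart e"
    using M A by (auto simp: smooth_manifold_def)
  let ?W = "snd c ` (fst c \<inter> fst d)"
  have cd: "transition c d (snd c q) = snd d q" if "q \<in> fst c" for q d
    using is_chartD(6)[OF ch(1) that] by (simp add: transition_def)
  have "(transition c d has_derivative frechet_derivative (transition c d) (at (snd c p))) (at (snd c p))"
    by (rule transition_has_derivative[OF M A(1,2)]) (use p in blast)
  moreover have "(transition d e has_derivative frechet_derivative (transition d e) (at (snd d p)))
      (at (transition c d (snd c p)))"
    unfolding cd[OF p(1)] by (rule transition_has_derivative[OF M A(2,3)]) (use p in blast)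
  ultimately have "((\<lambda>x. transition d e (transition c d x)) has_derivative (\<lambda>y.
      frechet_derivative (transition d e) (at (snd d p)) (frechet_derivative (transition c d) (at (snd c p)) y)))
      (at (snd c p))"
    by (rule has_derivative_compose)
  then have "(transition c e has_derivative (\<lambda>y.
      frechet_derivative (transition d e) (at (snd d p)) (frechet_derivative (transition c d) (at (snd c p)) y)))
      (at (snd c p))"
  proof (rule has_derivative_transform_within_open[OF _ open_chart_overlap[OF ch(1,2)]])
    show "snd c p \<in> ?W" using p by blast
    fix x assume "x \<in> ?W"
    then obtain q where q: "q \<in> fst c" "q \<in> fst d" "x = snd c q" by blast
    then show "transition d e (transition c d x) = transition c e x"
      using is_chartD(6)[OF ch(2)] by (simp add: cd) (simp add: transition_def)
  qed
  from fun_cong[OF frechet_derivative_at[OF this], of y] show ?thesis by (rule sym)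
qed

lemma coord_tvec_in_tangent_space:
  assumes M: "smooth_manifold A" and c: "c \<in> A" and x: "x \<in> chart_image c"
  shows "coord_tvec A c x y \<in> tangent_space A (chart_inv c x)"
proof -
  have ch: "is_chart c" using M c by (auto simp: smooth_manifold_def)
  let ?p = "chart_inv c x"
  have p: "?p \<in> fst c" "snd c ?p = x" using is_chartD[OF ch] x by auto
  have "coord_tvec A c x y e = frechet_derivative (transition d e) (at (snd d ?p)) (coord_tvec A c x y d)"
    if "d \<in> A" "e \<in> A" "?p \<in> fst d" "?p \<in> fst e" for d e
    using frechet_derivative_transition_compose[OF M c that(1,2) p(1) that(3,4), of y] that
    by (simp add: coord_tvec_def p(2))
  moreover have "coord_tvec A c x y d = 0" if "\<not> (d \<in> A \<and> ?p \<in> fst d)" for d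
    using that by (simp only: coord_tvec_def if_False)
  ultimately show ?thesis
    unfolding tangent_space_def by blast
qed

text \<open>In particular \<open>coord_tvec\<close> is nonzero for nonzero \<open>y\<close>, so that positivity of \<open>F\<close> passes to its
  coordinate expression.\<close>

lemma coord_tvec_own_chart:
  assumes M: "smooth_manifold A" and c: "c \<in> A" and x: "x \<in> chart_image c"
  shows "coord_tvec A c x y c = y"
proof -
  have ch: "is_chart c" using M c by (auto simp: smooth_manifold_def)
  have "(transition c c has_derivative (\<lambda>y. y)) (at x)"
    by (rule has_derivative_transform_within_open[OF has_derivative_ident is_chartD(2)[OF ch] x])
      (simp add: transition_def is_chartD(8)[OF ch])
  from fun_cong[OF frechet_derivative_at[OF this], of y] show ?thesis
    using is_chartD(7)[OF ch x] c by (simp add: coord_tvec_def)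
qed

lemma tangent_vector_eq_coord_tvec:
  assumes M: "smooth_manifold A" and c: "c \<in> A" and p: "p \<in> fst c" and v: "v \<in> tangent_space A p"
  shows "v = coord_tvec A c (snd c p) (v c)"
proof
  fix d
  have ch: "is_chart c" using M c by (auto simp: smooth_manifold_def)
  show "v d = coord_tvec A c (snd c p) (v c) d"
  proof (cases "d \<in> A \<and> p \<in> fst d")
    case True
    with v c p have "v d = frechet_derivative (transition c d) (at (snd c p)) (v c)"
      unfolding tangent_space_def by blast
    with True show ?thesis
      by (simp only: coord_tvec_def is_chartD(6)[OF ch p] simp_thms if_True)
  next
    case False
    with v have "v d = 0"
      unfolding tangent_space_def by blast
    with False show ?thesis
      by (simp only: coord_tvec_def is_chartD(6)[OF ch p] simp_thms if_False)
  qed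
qed

lemma finsler_local_rep_pos:
  assumes "finsler_space A F" "c \<in> A" "z \<in> slit_coords c"
  shows "local_rep A F c z > 0"
proof -
  obtain x y where z: "z = (x, y)" "x \<in> chart_image c" "y \<noteq> 0"
    using assms(3) by (auto simp: slit_coords_def)
  have M: "smooth_manifold A" using assms(1) by (simp add: finsler_space_def)
  have "coord_tvec A c x y \<noteq> (\<lambda>_. 0)"
    using coord_tvec_own_chart[OF M assms(2) z(2), of y] z(3) by metis
  then show ?thesis
    using assms(1) coord_tvec_in_tangent_space[OF M assms(2) z(2), of y]
    by (simp add: finsler_space_def local_rep_def z(1))
qed

section \<open>Parallel forms on a Finsler space\<close>

text \<open>Vanishing of a form at a point is thereby a condition free of charts, which can be tested in
  any chart around the point.\<close>

lemma form_vanishes_iff_components: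
  assumes M: "smooth_manifold A" and \<beta>: "one_form A \<beta>" and c: "c \<in> A" and p: "p \<in> fst c"
  shows "(\<forall>v\<in>tangent_space A p. \<beta> (p, v) = 0) \<longleftrightarrow> (\<forall>i. form_comp A \<beta> c i (snd c p) = 0)"
proof -
  have ch: "is_chart c" using M c by (auto simp: smooth_manifold_def)
  note x = is_chartD(5,6)[OF ch p]
  show ?thesis
  proof
    assume "\<forall>v\<in>tangent_space A p. \<beta> (p, v) = 0"
    then show "\<forall>i. form_comp A \<beta> c i (snd c p) = 0"
      using coord_tvec_in_tangent_space[OF M c x(1)] by (simp add: form_comp_def local_rep_def x(2))
  next
    assume 0: "\<forall>i. form_comp A \<beta> c i (snd c p) = 0"
    show "\<forall>v\<in>tangent_space A p. \<beta> (p, v) = 0"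
    proof
      fix v assume "v \<in> tangent_space A p"
      then have "\<beta> (p, v) = \<beta> (p, coord_tvec A c (snd c p) (v c))"
        using tangent_vector_eq_coord_tvec[OF M c p] by metis
      also have "\<dots> = local_rep A \<beta> c (snd c p, v c)"
        by (simp add: local_rep_def x(2))
      also have "\<dots> = (\<Sum>i\<in>UNIV. form_comp A \<beta> c i (snd c p) * v c $ i)"
        using \<beta> c x(1) by (simp add: one_form_def)
      finally show "\<beta> (p, v) = 0" using 0 by simp
    qed
  qed
qed

lemma smooth_on_finsler_berwald_conn:
  assumes "finsler_space A F" "c \<in> A"
  shows "smooth_on (slit_coords c) (berwald_conn (local_rep A F c) h i j)"
  using assms unfolding finsler_space_def smooth_manifold_def
  by (intro smooth_on_berwald_conn open_slit_coords) auto

text \<open>With \<open>y\<close> held at a constant nonzero vector, parallelism is a linear system in \<open>x\<close> alone.\<close>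

lemma open_form_zero_set:
  fixes A :: "('m::{t2_space,second_countable_topology}, 'n::finite) chart set"
  assumes F: "finsler_space A F" and \<beta>: "parallel_form A F \<beta>"
  shows "open {p. \<forall>v\<in>tangent_space A p. \<beta> (p, v) = 0}" (is "open ?Z")
proof (subst open_subopen, intro ballI)
  have M: "smooth_manifold A" using F by (simp add: finsler_space_def)
  have of: "one_form A \<beta>" using \<beta> by (simp add: parallel_form_def)
  fix p assume p: "p \<in> ?Z"
  obtain c where c: "c \<in> A" "p \<in> fst c"
    using M UNIV_I[of p] unfolding smooth_manifold_def by blast
  have ch: "is_chart c" using M c by (auto simp: smooth_manifold_def)
  let ?b = "form_comp A \<beta> c" and ?y = "axis undefined 1 :: real^'n"
  let ?\<Gamma> = "\<lambda>h i j x. berwald_conn (local_rep A F c) h i j (x, ?y)"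
  have y: "?y \<noteq> 0" by (simp add: axis_eq_0_iff)
  have "\<exists>e>0. ball (snd c p) e \<subseteq> chart_image c \<and> (\<forall>x\<in>ball (snd c p) e. \<forall>i. ?b i x = 0)"
  proof (rule zero_near_if_linear_system[where \<Gamma> = ?\<Gamma>])
    show "smooth_on (chart_image c) (?b i)" for i
      using of c by (simp add: one_form_def)
    show "continuous_on (chart_image c) (?\<Gamma> h i j)" for h i j
      by (rule continuous_on_compose2[OF smooth_on_continuous_on[OF smooth_on_finsler_berwald_conn[OF F c(1)]]])
        (auto intro!: continuous_intros simp: slit_coords_def y)
    show "frechet_derivative (?b i) (at x) (axis j 1) = (\<Sum>h\<in>UNIV. ?\<Gamma> h i j x * ?b h x)"
      if "x \<in> chart_image c" for x i j
      using \<beta> c that y by (fastforce simp: parallel_form_def slit_coords_def)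
    show "?b i (snd c p) = 0" for i
      using p form_vanishes_iff_components[OF M of c] by blast
  qed (use is_chartD[OF ch] c in auto)
  then obtain e where e: "e > 0" "\<And>x i. x \<in> ball (snd c p) e \<Longrightarrow> ?b i x = 0" by blast
  let ?T = "fst c \<inter> snd c -` ball (snd c p) e"
  have "open ?T" by (rule continuous_open_preimage[OF is_chartD(3,1)[OF ch] open_ball])
  moreover have "p \<in> ?T" using c e by simp
  moreover have "?T \<subseteq> ?Z"
    using form_vanishes_iff_components[OF M of c(1)] e(2) by blast
  ultimately show "\<exists>T. open T \<and> p \<in> T \<and> T \<subseteq> ?Z" by blast
qed

lemma closed_form_zero_set:
  assumes M: "smooth_manifold A" and \<beta>: "one_form A \<beta>"
  shows "closed {p. \<forall>v\<in>tangent_space A p. \<beta> (p, v) = 0}" (is "closed ?Z")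
  unfolding closed_def
proof (subst open_subopen, intro ballI)
  fix p assume p: "p \<in> - ?Z"
  obtain c where c: "c \<in> A" "p \<in> fst c"
    using M UNIV_I[of p] unfolding smooth_manifold_def by blast
  have ch: "is_chart c" using M c by (auto simp: smooth_manifold_def)
  have iff: "q \<in> ?Z \<longleftrightarrow> (\<forall>i. form_comp A \<beta> c i (snd c q) = 0)" if "q \<in> fst c" for q
    using form_vanishes_iff_components[OF M \<beta> c(1) that] by simp
  obtain i where i: "form_comp A \<beta> c i (snd c p) \<noteq> 0" using p iff[OF c(2)] by auto
  have "continuous_on (fst c) (\<lambda>q. form_comp A \<beta> c i (snd c q))"
  proof (rule continuous_on_compose2[OF _ is_chartD(3)[OF ch]])
    show "continuous_on (chart_image c) (form_comp A \<beta> c i)"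
      using \<beta> c by (auto simp: one_form_def intro: smooth_on_continuous_on)
  qed (auto simp: chart_image_def)
  then have "open (fst c \<inter> (\<lambda>q. form_comp A \<beta> c i (snd c q)) -` (- {0}))" (is "open ?T")
    by (rule continuous_open_preimage[OF _ is_chartD(1)[OF ch]]) auto
  moreover have "p \<in> ?T" using c i by simp
  moreover have "?T \<subseteq> - ?Z" using iff by auto
  ultimately show "\<exists>T. open T \<and> p \<in> T \<and> T \<subseteq> - ?Z" by blast
qed

lemma parallel_form_nowhere_zero:
  assumes F: "finsler_space A F" and \<beta>: "parallel_form A F \<beta>" "nonzero_form A \<beta>"
  shows "\<exists>v\<in>tangent_space A p. \<beta> (p, v) \<noteq> 0"
proof (rule ccontr)
  let ?Z = "{p. \<forall>v\<in>tangent_space A p. \<beta> (p, v) = 0}"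
  assume "\<not> ?thesis"
  then have p: "p \<in> ?Z" by auto
  obtain q where q: "q \<in> connected_component_set UNIV p" "q \<notin> ?Z"
    using \<beta>(2) unfolding nonzero_form_def by blast
  have "open ?Z" by (rule open_form_zero_set[OF F \<beta>(1)])
  moreover have "open (- ?Z)"
    using closed_form_zero_set[of A \<beta>] F \<beta>(1)
    by (simp only: closed_def finsler_space_def parallel_form_def)
  moreover have "connected (connected_component_set UNIV p)" by (rule connected_connected_component)
  ultimately have "?Z \<inter> connected_component_set UNIV p = {} \<or> - ?Z \<inter> connected_component_set UNIV p = {}"
    by (intro connectedD) auto
  moreover have "p \<in> connected_component_set UNIV p" by simp
  ultimately show False using p q by blast
qed

text \<open>In \<open>G\<^sup>h\<^sub>i\<^sub>j b\<^sub>h = \<partial>\<^sub>j b\<^sub>i\<close> the right-hand side depends on \<open>x\<close> only, so the derivative in \<open>y\<^sup>k\<close>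
  of the left-hand side is zero.\<close>

lemma parallel_form_annihilates_berwald_curv:
  assumes F: "finsler_space A F" and \<beta>: "parallel_form A F \<beta>" and c: "c \<in> A"
    and z: "(x, y) \<in> slit_coords c"
  shows "(\<Sum>h\<in>UNIV. form_comp A \<beta> c h x * berwald_curv (local_rep A F c) h i j k (x, y)) = 0"
proof -
  let ?C = "\<lambda>h. berwald_conn (local_rep A F c) h i j" and ?b = "\<lambda>h. form_comp A \<beta> c h x"
  have diff: "?C h differentiable (at (x, y))" for h
    by (rule smooth_on_differentiable[OF smooth_on_finsler_berwald_conn[OF F c] z])
  let ?f = "\<lambda>z. \<Sum>h\<in>UNIV. ?b h * ?C h z"
  have "dy k ?f (x, y) = 0"
  proof (rule dy_const_on_fibre[where V = "- {0}"])
    show "?f differentiable (at (x, y))"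
      using diff by (intro differentiable_sum differentiable_mult) auto
    show "?f (x, w) = frechet_derivative (form_comp A \<beta> c i) (at x) (axis j 1)" if "w \<in> - {0}" for w
    proof -
      have "(x, w) \<in> slit_coords c" using z that by (simp add: slit_coords_def)
      then show ?thesis
        using \<beta> c by (fastforce simp: parallel_form_def mult.commute)
    qed
  qed (use z in \<open>auto simp: slit_coords_def\<close>)
  moreover have "dy k ?f (x, y) = (\<Sum>h\<in>UNIV. ?b h * dy k (?C h) (x, y) + dy k (\<lambda>z. ?b h) (x, y) * ?C h (x, y))"
    by (rule dy_sum_mult) (simp_all add: diff)
  ultimately show ?thesis
    by (simp add: berwald_curv_def) (simp add: dy_def)
qed

theorem theorem3p3:
  fixes A :: "('m::{t2_space,second_countable_topology}, 'n::finite) chart set"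
    and F \<beta> :: "'m \<times> ('m, 'n) tvec \<Rightarrow> real"
  assumes "landsberg_space A F"
    and "parallel_form A F \<beta>"
    and "nonzero_form A \<beta>"
  shows "\<forall>c\<in>A. \<forall>z\<in>slit_coords c. rank (mean_berwald (local_rep A F c) z) \<le> CARD('n) - 2"
proof (intro ballI)
  fix c and z :: "(real^'n) \<times> (real^'n)"
  assume c: "c \<in> A" and z: "z \<in> slit_coords c"
  have F: "finsler_space A F" using assms(1) by (simp add: landsberg_space_def)
  have M: "smooth_manifold A" using F by (simp add: finsler_space_def)
  have ch: "is_chart c" using M c by (auto simp: smooth_manifold_def)
  obtain x y where xy: "z = (x, y)" "x \<in> chart_image c" "y \<noteq> 0"
    using z by (auto simp: slit_coords_def)
  let ?F = "local_rep A F c" and ?S = "slit_coords c"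
  have S: "open ?S" by (rule open_slit_coords[OF ch])
  have smooth: "smooth_on ?S ?F" using F c by (simp add: finsler_space_def)
  have "rank (mean_berwald ?F (x, y)) \<le> CARD('n) - 2"
  proof (rule landsberg_rank_mean_berwald[OF S smooth, where V = "- {0}" and b = "\<chi> i. form_comp A \<beta> c i x"])
    show "rank (metric_tensor ?F w) = CARD('n)" if "w \<in> ?S" for w
      using F c that by (simp add: finsler_space_def)
    show "(\<Sum>h\<in>UNIV. energy_covector ?F h w * berwald_curv ?F h i j k w) = 0" if "w \<in> ?S" for w i j k
    proof (rule energy_covector_annihilates_berwald_curv)
      show "?F differentiable (at w)" by (rule smooth_on_differentiable[OF smooth that])
      show "?F w \<noteq> 0" using finsler_local_rep_pos[OF F c that] by simp
      show "landsberg_curv ?F i j k w = 0" using assms(1) c that by (simp add: landsberg_space_def)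
    qed
    show "(\<Sum>h\<in>UNIV. (\<chi> i. form_comp A \<beta> c i x) $ h * berwald_curv ?F h i j k (x, w)) = 0"
      if "w \<in> - {0}" for w i j k
      using parallel_form_annihilates_berwald_curv[OF F assms(2) c, of x w i j k] that xy(2)
      by (simp add: slit_coords_def)
    have "\<not> (\<forall>i. form_comp A \<beta> c i x = 0)"
      using form_vanishes_iff_components[OF M _ c is_chartD(7)[OF ch xy(2)], of \<beta>] assms(2)
        parallel_form_nowhere_zero[OF F assms(2,3), of "chart_inv c x"] is_chartD(8)[OF ch xy(2)]
      by (auto simp: parallel_form_def)
    then show "(\<chi> i. form_comp A \<beta> c i x) \<noteq> 0" by (simp add: vec_eq_iff)
  qed (use xy in \<open>auto simp: slit_coords_def\<close>)
  then show "rank (mean_berwald ?F z) \<le> CARD('n) - 2" by (simp add: xy(1))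
qed

end
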